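(* Consider an instance $(X,U)$ of dimension $n$ of a problem class with cardinality bounds $\underline p,\bar p$ and cost bounds $0<m_\infty\le M_\infty$. Let $k\in[n]$ and let $M(n):=M_\infty\,\bar p(n)-m_\infty\,\underline p(n)$. Then the solution returned by the selection algorithm (Algorithm 1, described in the context) satisfies $$\mathrm{approx}(k)\le \mathrm{opt}(k')+M(n)\,\frac{n-k}{k+1}\qquad\text{for all } k'\ge k.$$
   Context: Notation: $\mathbb N=\{1,2,\dots\}$, $[k]=\{1,\dots,k\}$, $\mathbb R_+^n=\{x\in\mathbb R^n: x\ge 0\}$, and $\|x\|_0$ is the number of non-zero entries of $x$. An instance of dimension $n$ consists of a nonempty set $X\subseteq\{0,1\}^n$ and a nonempty convex set $U\subseteq\mathbb R_+^n$; all minima and maxima written are understood to be attained (e.g. $U$ compact). For $k\in\mathbb N$ the min-max-min robust problem $(\mathrm M^3(k))$ is $$\min_{x^{(1)},\dots,x^{(k)}\in X}\ \max_{c\in U}\ \min_{i=1,\dots,k} c^\top x^{(i)},$$ and $\mathrm{opt}(k)$ denotes its optimal value. A problem class has cardinality bounds $\underline p,\bar p:\mathbb N\to\mathbb R_+$ if for every instance of dimension $n$ in the class $\underline p(n)\le\|x\|_0\le\bar p(n)$ for all $x\in X$. Cost bounds $0<m_\infty\le M_\infty$ means that $m_\infty\le c_j\le M_\infty$ for all $c\in U$ and all $j\in[n]$. Algorithm 1 (input $n$, $k\in[n]$, $U$, $X$): (1) compute an optimal solution $x^1,\dots,x^n$ of $(\mathrm M^3(n))$; (2) compute an optimal solution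 $\lambda^*$ of $\min\{\max_{c\in U}c^\top x:\ x=\sum_{i=1}^n\lambda_i x^i,\ \sum_{i=1}^n\lambda_i=1,\ \lambda\ge 0\}$; (3) sort $\lambda^*_{i_1}\ge\lambda^*_{i_2}\ge\dots\ge\lambda^*_{i_n}$; (4) return $x^{i_1},\dots,x^{i_k}$. The objective value of the returned solution is $\mathrm{approx}(k):=\max_{c\in U}\min_{j=1,\dots,k}c^\top x^{i_j}$. *)

theory Defs
  imports "HOL-Analysis.Analysis"
begin

text \<open>
  The dimension \<open>n\<close> is \<open>CARD('n)\<close>. Tuples \<open>x\<^sub>1, \<dots>, x\<^sub>k\<close> of elements of \<open>X\<close> are elements of
  \<open>{1..k} \<rightarrow>\<^sub>E X\<close>. A maximum over the uncountable set \<open>U\<close> is written as a supremum; that it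
  is attained is the separate hypothesis \<open>maxima_attained\<close>.
\<close>

definition m3_instance :: "(real^'n) set \<Rightarrow> (real^'n) set \<Rightarrow> bool" where
  "m3_instance X U \<longleftrightarrow>
     X \<noteq> {} \<and> (\<forall>x\<in>X. \<forall>j. x $ j \<in> {0, 1}) \<and>
     U \<noteq> {} \<and> convex U \<and> (\<forall>c\<in>U. \<forall>j. c $ j \<ge> 0)"

definition l0 :: "real^'n \<Rightarrow> nat" where
  "l0 x = card {j. x $ j \<noteq> 0}"

text \<open>
  Since the dimension is a type, \<open>\<C>\<close> holds only the \<open>n\<close>-dimensional instances \<open>(X, U)\<close> of a
  problem class. The bounds themselves are functions of an arbitrary dimension.
\<close>

definition cardinality_bounds ::
    "((real^'n) set \<times> (real^'n) set) set \<Rightarrow> (nat \<Rightarrow> real) \<Rightarrow> (nat \<Rightarrow> real) \<Rightarrow> bool" where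
  "cardinality_bounds \<C> p_lo p_hi \<longleftrightarrow>
     (\<forall>d\<ge>1. p_lo d \<ge> 0 \<and> p_hi d \<ge> 0) \<and>
     (\<forall>(X, U)\<in>\<C>. \<forall>x\<in>X. p_lo CARD('n) \<le> real (l0 x) \<and> real (l0 x) \<le> p_hi CARD('n))"

definition cost_bounds :: "(real^'n) set \<Rightarrow> real \<Rightarrow> real \<Rightarrow> bool" where
  "cost_bounds U m_inf M_inf \<longleftrightarrow>
     0 < m_inf \<and> m_inf \<le> M_inf \<and> (\<forall>c\<in>U. \<forall>j. m_inf \<le> c $ j \<and> c $ j \<le> M_inf)"

definition m3_value :: "(real^'n) set \<Rightarrow> nat \<Rightarrow> (nat \<Rightarrow> real^'n) \<Rightarrow> real" where
  "m3_value U k x = (SUP c\<in>U. MIN i\<in>{1..k}. c \<bullet> x i)"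

definition m3_opt :: "(real^'n) set \<Rightarrow> (real^'n) set \<Rightarrow> nat \<Rightarrow> real" where
  "m3_opt X U k = (MIN x\<in>{1..k} \<rightarrow>\<^sub>E X. m3_value U k x)"

definition m3_optimal :: "(real^'n) set \<Rightarrow> (real^'n) set \<Rightarrow> nat \<Rightarrow> (nat \<Rightarrow> real^'n) \<Rightarrow> bool" where
  "m3_optimal X U k x \<longleftrightarrow> is_arg_min (m3_value U k) (\<lambda>y. y \<in> {1..k} \<rightarrow>\<^sub>E X) x"

definition simplex_weights :: "nat \<Rightarrow> (nat \<Rightarrow> real) \<Rightarrow> bool" where
  "simplex_weights n l \<longleftrightarrow> (\<Sum>i\<in>{1..n}. l i) = 1 \<and> (\<forall>i\<in>{1..n}. l i \<ge> 0)"

definition comb_value ::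
    "(real^'n) set \<Rightarrow> nat \<Rightarrow> (nat \<Rightarrow> real^'n) \<Rightarrow> (nat \<Rightarrow> real) \<Rightarrow> real" where
  "comb_value U n x l = (SUP c\<in>U. c \<bullet> (\<Sum>i\<in>{1..n}. l i *\<^sub>R x i))"

definition comb_optimal ::
    "(real^'n) set \<Rightarrow> nat \<Rightarrow> (nat \<Rightarrow> real^'n) \<Rightarrow> (nat \<Rightarrow> real) \<Rightarrow> bool" where
  "comb_optimal U n x l \<longleftrightarrow> is_arg_min (comb_value U n x) (simplex_weights n) l"

text \<open>
  Only the maxima over \<open>U\<close> need this: the minima over tuples range over finite sets, and the
  minimum over weights enters only through a minimiser, in \<open>algorithm1\<close>.
\<close>

definition maxima_attained :: "(real^'n) set \<Rightarrow> (real^'n) set \<Rightarrow> bool" where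
  "maxima_attained X U \<longleftrightarrow>
     (\<forall>k::nat\<ge>1. \<forall>x\<in>{1..k} \<rightarrow>\<^sub>E X.
        \<exists>c. is_arg_max (\<lambda>c. MIN i\<in>{1..k}. c \<bullet> x i) (\<lambda>c. c \<in> U) c) \<and>
     (\<forall>x\<in>{1..CARD('n)} \<rightarrow>\<^sub>E X. \<forall>l. simplex_weights CARD('n) l \<longrightarrow>
        (\<exists>c. is_arg_max (\<lambda>c. c \<bullet> (\<Sum>i\<in>{1..CARD('n)}. l i *\<^sub>R x i)) (\<lambda>c. c \<in> U) c))"

text \<open>
  \<open>algorithm1 X U k z\<close>: the tuple \<open>z\<close> is a possible output, for some choice of the optimal
  solutions in the first two steps and some way of breaking ties when sorting.
\<close>

definition algorithm1 ::
    "(real^'n) set \<Rightarrow> (real^'n) set \<Rightarrow> nat \<Rightarrow> (nat \<Rightarrow> real^'n) \<Rightarrow> bool" where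
  "algorithm1 X U k z \<longleftrightarrow>
     (\<exists>x l s. m3_optimal X U CARD('n) x \<and>
        comb_optimal U CARD('n) x l \<and>
        bij_betw s {1..CARD('n)} {1..CARD('n)} \<and>
        (\<forall>a\<in>{1..CARD('n)}. \<forall>b\<in>{1..CARD('n)}. a \<le> b \<longrightarrow> l (s b) \<le> l (s a)) \<and>
        z = (\<lambda>j\<in>{1..k}. x (s j)))"

end

theory Submission
  imports Defs
begin

text \<open>
  By the minimax theorem, the value of a tuple \<open>y\<close> equals the least worst-case cost of a point in
  the convex hull of \<open>y\<close>. As all vectors are nonnegative, a Caratheodory argument that may
  decrease the point shows that \<open>n\<close> instead of \<open>n + 1\<close> vectors suffice, so \<open>opt(n) \<le> opt(k')\<close>
  for every \<open>k'\<close>, and the convex combination of step 2 has worst-case cost at most \<open>opt(n)\<close>.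
  Dropping the \<open>n - k\<close> smallest weights loses at most \<open>M(n)\<close> times their sum, and
  this sum is at most \<open>(n - k) / (k + 1)\<close> as the weights are sorted and sum up to 1.
\<close>

section \<open>Minimax for finitely many vectors over a convex cost set\<close>

lemma nonneg_if_ray_bounded:
  fixes a p :: real
  assumes "\<And>r. r \<ge> 0 \<Longrightarrow> p \<le> a * r"
  shows "a \<ge> 0"
proof (rule ccontr)
  assume a: "\<not> a \<ge> 0"
  then have "p \<le> a * ((\<bar>p\<bar> + 1) / (- a))" by (intro assms divide_nonneg_pos) auto
  also have "\<dots> = - (\<bar>p\<bar> + 1)" using a by simp
  finally show False by simp
qed

text \<open>Separation in the plane of value pairs: the hypothesis keeps the origin out of a convex,
  downward closed set, and the normal of a separating line, once normalised, gives the two weights.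
  No compactness of \<open>U\<close> is needed because the level \<open>v\<close> is fixed in
  advance.\<close>

lemma minimax_two_points:
  fixes U :: "'a::real_inner set"
  assumes "convex U" "U \<noteq> {}" and le: "\<And>c. c \<in> U \<Longrightarrow> c \<bullet> x \<le> v \<or> c \<bullet> y \<le> v"
  obtains t where "0 \<le> t" "t \<le> 1" "\<And>c. c \<in> U \<Longrightarrow> c \<bullet> ((1 - t) *\<^sub>R x + t *\<^sub>R y) \<le> v"
proof -
  \<comment> \<open>Strict inequalities keep 0 out of \<open>K\<close>: a cost vector placing 0 in
    \<open>K\<close> would make both \<open>x\<close> and \<open>y\<close> cost more than
    \<open>v\<close>. Downward closure of \<open>K\<close> later fixes the signs of the
    normal.\<close>
  define K where "K = {pq. \<exists>c\<in>U. fst pq < c \<bullet> x - v \<and> snd pq < c \<bullet> y - v}"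
  have "convex K"
  proof (rule convexI)
    fix a b and s t :: real
    assume "a \<in> K" "b \<in> K" and st: "0 \<le> s" "0 \<le> t" "s + t = 1"
    then obtain c d where c: "c \<in> U" "fst a < c \<bullet> x - v" "snd a < c \<bullet> y - v"
      and d: "d \<in> U" "fst b < d \<bullet> x - v" "snd b < d \<bullet> y - v"
      by (auto simp: K_def)
    have *: "s * p + t * q < s * p' + t * q'" if "p < p'" "q < q'" for p q p' q' :: real
      using st that convex_bound_lt[of "p - p'" 0 "q - q'" s t] by (simp add: algebra_simps)
    have **: "(s *\<^sub>R c + t *\<^sub>R d) \<bullet> z - v = s * (c \<bullet> z - v) + t * (d \<bullet> z - v)" for z
    proof -
      have "v = s * v + t * v" using st by (metis distrib_right mult_1)
      then show ?thesis by (simp add: inner_add_left algebra_simps)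
    qed
    show "s *\<^sub>R a + t *\<^sub>R b \<in> K"
      unfolding K_def mem_Collect_eq
    proof (rule bexI[of _ "s *\<^sub>R c + t *\<^sub>R d"])
      show "s *\<^sub>R c + t *\<^sub>R d \<in> U" using assms(1) c(1) d(1) st by (rule convexD)
    qed (use ** *[OF c(2) d(2)] *[OF c(3) d(3)] in simp)
  qed
  moreover have "0 \<notin> K" using le by (force simp: K_def)
  ultimately obtain a where a: "a \<noteq> 0" "\<And>p. p \<in> K \<Longrightarrow> 0 \<le> a \<bullet> p"
    by (metis separating_hyperplane_set_0[of K])
  \<comment> \<open>\<open>K\<close> is unbounded downwards and lies on the side
    \<open>0 \<le> a \<bullet> p\<close>, so the entries of \<open>a\<close> are nonpositive; the
    negated ones serve as weights.\<close>
  define \<alpha> \<beta> where "\<alpha> = - fst a" and "\<beta> = - snd a"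
  have sep: "\<alpha> * p + \<beta> * q \<le> 0" if "c \<in> U" "p < c \<bullet> x - v" "q < c \<bullet> y - v" for c p q
  proof -
    have "(p, q) \<in> K" using that by (auto simp: K_def)
    from a(2)[OF this] show ?thesis by (simp add: \<alpha>_def \<beta>_def inner_prod_def)
  qed
  obtain c0 where c0: "c0 \<in> U" using \<open>U \<noteq> {}\<close> by blast
  \<comment> \<open>The shift by 1 puts \<open>(P, Q)\<close> strictly inside the bounds given by
    \<open>c0\<close>, so lowering either coordinate arbitrarily stays in \<open>K\<close>; the two
    rays show \<open>\<alpha> \<ge> 0\<close> and \<open>\<beta> \<ge> 0\<close>.\<close>
  define P where "P = c0 \<bullet> x - v - 1"
  define Q where "Q = c0 \<bullet> y - v - 1"
  have PQ: "\<alpha> * (P - r) + \<beta> * (Q - s) \<le> 0" if "r \<ge> 0" "s \<ge> 0" for r s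
    using that by (intro sep[OF c0]) (auto simp: P_def Q_def)
  have "\<alpha> \<ge> 0"
    using PQ[of _ 0] by (intro nonneg_if_ray_bounded[of "\<alpha> * P + \<beta> * Q"]) (simp add: algebra_simps)
  moreover have "\<beta> \<ge> 0"
    using PQ[of 0] by (intro nonneg_if_ray_bounded[of "\<alpha> * P + \<beta> * Q"]) (simp add: algebra_simps)
  moreover have "\<alpha> \<noteq> 0 \<or> \<beta> \<noteq> 0"
    using a(1) by (simp add: \<alpha>_def \<beta>_def prod_eq_iff)
  ultimately have ab: "\<alpha> \<ge> 0" "\<beta> \<ge> 0" "\<alpha> + \<beta> > 0" by auto
  \<comment> \<open>The pair of exact values is not covered by the strict inequalities of
    \<open>sep\<close>, so both coordinates are lowered by \<open>d\<close>, at a total loss of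
    \<open>e\<close>.\<close>
  have le0: "\<alpha> * (c \<bullet> x - v) + \<beta> * (c \<bullet> y - v) \<le> 0" if "c \<in> U" for c
  proof (rule field_le_epsilon)
    fix e :: real assume "e > 0"
    define d where "d = e / (\<alpha> + \<beta>)"
    have "d > 0" and d: "(\<alpha> + \<beta>) * d = e" using \<open>e > 0\<close> ab by (auto simp: d_def)
    then have "\<alpha> * (c \<bullet> x - v - d) + \<beta> * (c \<bullet> y - v - d) \<le> 0"
      by (intro sep[OF that]) auto
    then show "\<alpha> * (c \<bullet> x - v) + \<beta> * (c \<bullet> y - v) \<le> 0 + e"
      using d by (simp add: algebra_simps)
  qed
  show thesis
  proof (rule that[of "\<beta> / (\<alpha> + \<beta>)"])
    fix c assume "c \<in> U"
    have "1 - \<beta> / (\<alpha> + \<beta>) = \<alpha> / (\<alpha> + \<beta>)" using ab by (simp add: field_simps)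
    then have "c \<bullet> ((1 - \<beta> / (\<alpha> + \<beta>)) *\<^sub>R x + (\<beta> / (\<alpha> + \<beta>)) *\<^sub>R y)
        = (\<alpha> * (c \<bullet> x) + \<beta> * (c \<bullet> y)) / (\<alpha> + \<beta>)"
      by (simp add: inner_add_right add_divide_distrib)
    also have "\<dots> \<le> v" using le0[OF \<open>c \<in> U\<close>] ab by (simp add: divide_le_eq algebra_simps)
    finally show "c \<bullet> ((1 - \<beta> / (\<alpha> + \<beta>)) *\<^sub>R x + (\<beta> / (\<alpha> + \<beta>)) *\<^sub>R y) \<le> v" .
  qed (use ab in auto)
qed

text \<open>Induction on \<open>A\<close> with \<open>U\<close> varying: on the convex subset
  \<open>U'\<close> where \<open>x\<close> is too expensive, the vectors of \<open>F\<close> must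
  suffice and yield \<open>w\<close>. Every cost vector in \<open>U\<close> then accepts
  \<open>x\<close> or \<open>w\<close>, which is the two-point case. Since \<open>U'\<close> may be
  empty, the statement allows empty \<open>U\<close>.\<close>

lemma minimax_convex_hull:
  fixes U A :: "'a::real_inner set"
  assumes "finite A" "A \<noteq> {}" "convex U" "\<And>c. c \<in> U \<Longrightarrow> \<exists>y\<in>A. c \<bullet> y \<le> v"
  shows "\<exists>w\<in>convex hull A. \<forall>c\<in>U. c \<bullet> w \<le> v"
  using assms
proof (induction A arbitrary: U rule: finite_ne_induct)
  case (singleton x)
  then show ?case by auto
next
  case (insert x F)
  define U' where "U' = {c \<in> U. v < c \<bullet> x}"
  have "U' = U \<inter> {c. v < x \<bullet> c}" by (auto simp: U'_def inner_commute)
  then have "convex U'"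
    using insert.prems(1) by (simp add: convex_Int convex_halfspace_gt)
  then obtain w where w: "w \<in> convex hull F" "\<And>c. c \<in> U' \<Longrightarrow> c \<bullet> w \<le> v"
    using insert.IH[of U'] insert.prems(2) unfolding U'_def by force
  have x: "x \<in> convex hull (insert x F)" and w': "w \<in> convex hull (insert x F)"
    using w(1) hull_mono[of F "insert x F"] by (auto intro: hull_inc)
  show ?case
  proof (cases "U = {}")
    case True
    then show ?thesis using x by auto
  next
    case False
    have "c \<bullet> x \<le> v \<or> c \<bullet> w \<le> v" if "c \<in> U" for c
      using w(2)[of c] that unfolding U'_def by force
    then obtain t where t: "0 \<le> t" "t \<le> 1"
      and "\<And>c. c \<in> U \<Longrightarrow> c \<bullet> ((1 - t) *\<^sub>R x + t *\<^sub>R w) \<le> v"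
      using minimax_two_points[OF insert.prems(1) False] by metis
    moreover have "(1 - t) *\<^sub>R x + t *\<^sub>R w \<in> convex hull (insert x F)"
      using t x w' by (intro convexD[OF convex_convex_hull]) auto
    ultimately show ?thesis by blast
  qed
qed

section \<open>Caratheodory reduction for nonnegative vectors\<close>

text \<open>A linear dependence may be negated, so its coefficient sum can be taken nonnegative.
  Adding a nonnegative multiple of it to convex weights then does not lower their sum.\<close>

lemma dependent_nonneg_combination:
  fixes A :: "(real^'n) set"
  assumes "dependent A" "finite A"
  obtains \<mu> j where "(\<Sum>a\<in>A. \<mu> a *\<^sub>R a) = 0" "(\<Sum>a\<in>A. \<mu> a) \<ge> 0" "j \<in> A" "\<mu> j \<noteq> 0"
proof -
  obtain \<mu> j where \<mu>: "j \<in> A" "\<mu> j \<noteq> 0" "(\<Sum>a\<in>A. \<mu> a *\<^sub>R a) = 0"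
    using assms dependent_finite by blast
  show thesis
  proof (cases "(\<Sum>a\<in>A. \<mu> a) \<ge> 0")
    case True
    then show thesis using \<mu> that by blast
  next
    case False
    then show thesis
      using \<mu> that[of "\<lambda>a. - \<mu> a" j] by (simp add: sum_negf)
  qed
qed

text \<open>Linear instead of affine dependence saves one vector over the usual bound
  \<open>n + 1\<close>. Shifting the weights along a dependence until one vanishes keeps
  \<open>w\<close> but may raise the total weight to \<open>\<sigma> \<ge> 1\<close>; normalising
  gives \<open>w / \<sigma>\<close>, which lies below \<open>w\<close> because \<open>w\<close> is
  nonnegative.\<close>

lemma caratheodory_nonneg:
  fixes A :: "(real^'n) set"
  assumes "finite A" "\<And>a i. a \<in> A \<Longrightarrow> 0 \<le> a $ i" "w \<in> convex hull A"
  shows "\<exists>B u. B \<subseteq> A \<and> card B \<le> CARD('n) \<and> u \<in> convex hull B \<and> (\<forall>i. u $ i \<le> w $ i)"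
  using assms
proof (induction "card A" arbitrary: A w rule: less_induct)
  case less
  note fin = less.prems(1) and nn = less.prems(2)
  obtain l where l: "\<And>a. a \<in> A \<Longrightarrow> 0 \<le> l a" "sum l A = 1" "(\<Sum>a\<in>A. l a *\<^sub>R a) = w"
    using less.prems(3) unfolding convex_hull_finite[OF fin] by blast
  have w0: "0 \<le> w $ i" for i
    unfolding l(3)[symmetric] using l(1) nn by (auto intro!: sum_nonneg)
  show ?case
  proof (cases "card A \<le> CARD('n)")
    case True
    then show ?thesis using less.prems(3) by blast
  next
    case False
    then have "dependent A" using independent_bound[of A] by auto
    then obtain \<mu> j where \<mu>: "(\<Sum>a\<in>A. \<mu> a *\<^sub>R a) = 0" "(\<Sum>a\<in>A. \<mu> a) \<ge> 0" "j \<in> A" "\<mu> j \<noteq> 0"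
      using dependent_nonneg_combination fin by blast
    show ?thesis
    proof (cases "\<forall>a\<in>A. \<mu> a \<ge> 0")
      case True
      \<comment> \<open>A vanishing sum of nonnegative terms forces \<open>j\<close> to be the zero
        vector, and this single vector already lies below \<open>w\<close>.\<close>
      have "j $ i = 0" for i
      proof -
        have "(\<Sum>a\<in>A. \<mu> a * a $ i) = 0"
          using arg_cong[OF \<mu>(1), of "\<lambda>x. x $ i"] by simp
        then have "\<mu> j * j $ i = 0"
          using fin True nn \<mu>(3) by (subst (asm) sum_nonneg_eq_0_iff) auto
        then show ?thesis using \<mu>(4) by simp
      qed
      then show ?thesis
        using \<mu>(3) w0 by (intro exI[of _ "{j}"] exI[of _ j]) (auto simp: Suc_le_eq)
    next
      case False
      define N where "N = {a \<in> A. \<mu> a < 0}"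
      have N: "finite N" "N \<noteq> {}" using False fin by (auto simp: N_def)
      \<comment> \<open>The largest step that keeps all shifted weights nonnegative; the vector
        \<open>b\<close> attaining the minimum loses its weight and can be removed.\<close>
      define t where "t = (MIN a\<in>N. l a / (- \<mu> a))"
      have "t \<in> (\<lambda>a. l a / (- \<mu> a)) ` N" unfolding t_def using N by (intro Min_in) auto
      then obtain b where b: "b \<in> A" "\<mu> b < 0" "t = l b / (- \<mu> b)" by (auto simp: N_def)
      have t0: "t \<ge> 0" using b l(1)[of b] by (simp add: divide_nonneg_neg)
      define l' where "l' a = l a + t * \<mu> a" for a
      have l'b: "l' b = 0" using b by (simp add: l'_def)
      have l'0: "l' a \<ge> 0" if "a \<in> A" for a
      proof (cases "\<mu> a < 0")
        case True
        then have "t \<le> l a / (- \<mu> a)" unfolding t_def using N that by (intro Min_le) (auto simp: N_def)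
        then show ?thesis using True by (simp add: l'_def field_simps)
      qed (use l(1)[OF that] t0 in \<open>simp add: l'_def\<close>)
      define \<sigma> where "\<sigma> = sum l' A"
      have "\<sigma> = 1 + t * (\<Sum>a\<in>A. \<mu> a)"
        by (simp add: \<sigma>_def l'_def sum.distrib l(2) sum_distrib_left)
      then have \<sigma>1: "\<sigma> \<ge> 1" using t0 \<mu>(2) by simp
      have l'w: "(\<Sum>a\<in>A. l' a *\<^sub>R a) = w"
        using \<mu>(1) by (simp add: l'_def scaleR_add_left sum.distrib l(3) scaleR_sum_right[symmetric]
          flip: scaleR_scaleR)
      let ?A = "A - {b}"
      have "(\<Sum>a\<in>?A. (l' a / \<sigma>) *\<^sub>R a) = (1 / \<sigma>) *\<^sub>R (\<Sum>a\<in>A. l' a *\<^sub>R a)"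
        using fin b(1) l'b by (subst (2) sum.remove) (auto simp: scaleR_sum_right)
      moreover have "(\<Sum>a\<in>?A. l' a / \<sigma>) = 1"
        using fin b(1) l'b \<sigma>1 sum.remove[OF fin b(1), of l']
        by (simp add: \<sigma>_def flip: sum_divide_distrib)
      ultimately have "(1 / \<sigma>) *\<^sub>R w \<in> convex hull ?A"
        using fin l'0 \<sigma>1 l'w
        by (subst convex_hull_finite) (auto intro!: exI[of _ "\<lambda>a. l' a / \<sigma>"])
      moreover have "card ?A < card A" using fin b(1) by (rule card_Diff1_less)
      ultimately obtain B u where "B \<subseteq> ?A" "card B \<le> CARD('n)" "u \<in> convex hull B"
        and u: "\<And>i. u $ i \<le> ((1 / \<sigma>) *\<^sub>R w) $ i"
        using less.hyps[of ?A "(1 / \<sigma>) *\<^sub>R w"] fin nn by auto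
      moreover have "u $ i \<le> w $ i" for i
      proof -
        have "w $ i / \<sigma> \<le> w $ i / 1" using \<sigma>1 w0[of i] by (intro divide_left_mono) auto
        then show ?thesis using u[of i] by simp
      qed
      ultimately show ?thesis by blast
    qed
  qed
qed

section \<open>Weights on tuples and attained maxima\<close>

text \<open>A tuple may repeat a vector, so weights belong to positions rather than to points. The
  combinations with such weights form a convex set containing every \<open>x i\<close>, hence
  contain the hull.\<close>

lemma convex_hull_tuple:
  assumes "w \<in> convex hull (x ` {1..n})"
  obtains l where "simplex_weights n l" "w = (\<Sum>i\<in>{1..n}. l i *\<^sub>R x i)"
proof -
  let ?S = "{\<Sum>i\<in>{1..n}. l i *\<^sub>R x i |l. simplex_weights n l}"
  have "convex ?S"
  proof (rule convexI)
    fix a b and s t :: real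
    assume "a \<in> ?S" "b \<in> ?S" and st: "0 \<le> s" "0 \<le> t" "s + t = 1"
    then obtain l m where l: "simplex_weights n l" "a = (\<Sum>i\<in>{1..n}. l i *\<^sub>R x i)"
      and m: "simplex_weights n m" "b = (\<Sum>i\<in>{1..n}. m i *\<^sub>R x i)" by blast
    have "simplex_weights n (\<lambda>i. s * l i + t * m i)"
      using l(1) m(1) st
      by (auto simp: simplex_weights_def sum.distrib simp flip: sum_distrib_left)
    moreover have "s *\<^sub>R a + t *\<^sub>R b = (\<Sum>i\<in>{1..n}. (s * l i + t * m i) *\<^sub>R x i)"
      by (simp add: l(2) m(2) scaleR_sum_right scaleR_add_left sum.distrib)
    ultimately show "s *\<^sub>R a + t *\<^sub>R b \<in> ?S"
      by (intro CollectI exI[of _ "\<lambda>i. s * l i + t * m i"] conjI)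
  qed
  moreover have "x ` {1..n} \<subseteq> ?S"
  proof clarify
    fix i assume i: "i \<in> {1..n}"
    have "x i = (\<Sum>j\<in>{1..n}. (if j = i then 1 else 0) *\<^sub>R x j)"
      using i by (simp add: if_distrib[of "\<lambda>r. r *\<^sub>R _"] cong: if_cong)
    moreover have "simplex_weights n (\<lambda>j. if j = i then 1 else 0)"
      using i by (simp add: simplex_weights_def)
    ultimately show "\<exists>l. x i = (\<Sum>i\<in>{1..n}. l i *\<^sub>R x i) \<and> simplex_weights n l"
      by (intro exI[of _ "\<lambda>j. if j = i then 1 else 0"]) auto
  qed
  ultimately have "convex hull (x ` {1..n}) \<subseteq> ?S" by (simp add: hull_minimal)
  then show thesis using assms that by blast
qed

lemma SUP_eq_arg_max:
  fixes f :: "'a \<Rightarrow> real"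
  assumes "is_arg_max f (\<lambda>c. c \<in> U) c0"
  shows "c0 \<in> U" "(SUP c\<in>U. f c) = f c0" "\<And>c. c \<in> U \<Longrightarrow> f c \<le> f c0"
proof -
  show c0: "c0 \<in> U" and le: "\<And>c. c \<in> U \<Longrightarrow> f c \<le> f c0"
    using assms by (auto simp: is_arg_max_linorder)
  show "(SUP c\<in>U. f c) = f c0"
    using c0 le by (intro cSup_eq_maximum) auto
qed

section \<open>Tuple values and worst-case costs over convex hulls\<close>

context
  fixes X U :: "(real^'n) set"
  assumes inst: "m3_instance X U" and max_att: "maxima_attained X U"
begin

lemma finite_X: "finite X"
proof (rule finite_subset)
  let ?F = "{v :: real^'n. \<forall>j. v $ j \<in> {0, 1}}"
  show "X \<subseteq> ?F" using inst by (auto simp: m3_instance_def)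
  have "?F \<subseteq> vec_lambda ` (UNIV \<rightarrow>\<^sub>E {0, 1})"
  proof
    fix v :: "real^'n" assume "v \<in> ?F"
    then have "vec_nth v \<in> UNIV \<rightarrow>\<^sub>E {0, 1}" by auto
    then show "v \<in> vec_lambda ` (UNIV \<rightarrow>\<^sub>E {0, 1})" by (metis image_eqI vec_nth_inverse)
  qed
  then show "finite ?F" by (rule finite_subset) (intro finite_imageI finite_PiE; simp)
qed

lemma m3_value_attained:
  assumes "k \<ge> 1" "x \<in> {1..k} \<rightarrow>\<^sub>E X"
  obtains c0 where "c0 \<in> U" "m3_value U k x = (MIN i\<in>{1..k}. c0 \<bullet> x i)"
    "\<And>c. c \<in> U \<Longrightarrow> (MIN i\<in>{1..k}. c \<bullet> x i) \<le> m3_value U k x"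
proof -
  obtain c0 where "is_arg_max (\<lambda>c. MIN i\<in>{1..k}. c \<bullet> x i) (\<lambda>c. c \<in> U) c0"
    using max_att assms unfolding maxima_attained_def by blast
  note * = SUP_eq_arg_max[OF this]
  show thesis
    by (rule that[OF *(1)]) (use *(2,3) in \<open>simp_all add: m3_value_def\<close>)
qed

lemma le_comb_value:
  assumes "x \<in> {1..CARD('n)} \<rightarrow>\<^sub>E X" "simplex_weights CARD('n) l" "c \<in> U"
  shows "c \<bullet> (\<Sum>i\<in>{1..CARD('n)}. l i *\<^sub>R x i) \<le> comb_value U CARD('n) x l"
proof -
  obtain c0 where "is_arg_max (\<lambda>c. c \<bullet> (\<Sum>i\<in>{1..CARD('n)}. l i *\<^sub>R x i)) (\<lambda>c. c \<in> U) c0"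
    using max_att assms unfolding maxima_attained_def by blast
  note * = SUP_eq_arg_max[OF this]
  show ?thesis unfolding comb_value_def *(2) using assms(3) by (rule *(3))
qed

lemma comb_value_le:
  assumes "\<And>c. c \<in> U \<Longrightarrow> c \<bullet> (\<Sum>i\<in>{1..k}. l i *\<^sub>R x i) \<le> v"
  shows "comb_value U k x l \<le> v"
  unfolding comb_value_def using inst assms by (intro cSUP_least) (auto simp: m3_instance_def)

text \<open>The hard half of the duality: under each cost vector a cheapest member of the tuple
  costs at most the tuple's value, so the minimax result applies at that level.\<close>

lemma convex_hull_le_m3_value:
  assumes "k \<ge> 1" "x \<in> {1..k} \<rightarrow>\<^sub>E X"
  obtains w where "w \<in> convex hull (x ` {1..k})" "\<And>c. c \<in> U \<Longrightarrow> c \<bullet> w \<le> m3_value U k x"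
proof -
  have "\<exists>y\<in>x ` {1..k}. c \<bullet> y \<le> m3_value U k x" if "c \<in> U" for c
  proof -
    have "(MIN i\<in>{1..k}. c \<bullet> x i) \<in> (\<lambda>i. c \<bullet> x i) ` {1..k}"
      using \<open>k \<ge> 1\<close> by (intro Min_in) auto
    then obtain i where i: "i \<in> {1..k}" "(MIN i\<in>{1..k}. c \<bullet> x i) = c \<bullet> x i" by blast
    have "(MIN i\<in>{1..k}. c \<bullet> x i) \<le> m3_value U k x"
      using m3_value_attained[OF assms] that by blast
    then show ?thesis using i by auto
  qed
  then show thesis
    using minimax_convex_hull[of "x ` {1..k}" U "m3_value U k x"] inst \<open>k \<ge> 1\<close> that
    by (auto simp: m3_instance_def)
qed

text \<open>The easy half: a maximising \<open>c0\<close> prices every member of the tuple at least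
  at its value, hence also every point of the hull, in particular \<open>u\<close>.\<close>

lemma m3_value_le_convex_hull:
  assumes "k \<ge> 1" "x \<in> {1..k} \<rightarrow>\<^sub>E X" "u \<in> convex hull (x ` {1..k})"
    "\<And>c. c \<in> U \<Longrightarrow> c \<bullet> u \<le> v"
  shows "m3_value U k x \<le> v"
proof -
  obtain c0 where c0: "c0 \<in> U" "m3_value U k x = (MIN i\<in>{1..k}. c0 \<bullet> x i)"
    using m3_value_attained[OF assms(1,2)] by blast
  have "convex hull (x ` {1..k}) \<subseteq> {z. c0 \<bullet> z \<ge> m3_value U k x}"
    by (intro hull_minimal convex_halfspace_ge) (auto simp: c0(2))
  then show ?thesis using assms(3) assms(4)[OF c0(1)] by force
qed

lemma m3_opt_attained:
  obtains y where "y \<in> {1..k} \<rightarrow>\<^sub>E X" "m3_opt X U k = m3_value U k y"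
proof -
  have "m3_opt X U k \<in> m3_value U k ` ({1..k} \<rightarrow>\<^sub>E X)"
    unfolding m3_opt_def using inst finite_X
    by (intro Min_in finite_imageI finite_PiE) (auto simp: m3_instance_def PiE_eq_empty_iff)
  then show thesis using that by blast
qed

text \<open>An optimal \<open>k\<close>-tuple yields a hull point \<open>w\<close>. Caratheodory
  replaces it by some \<open>u\<close> below \<open>w\<close> using at most \<open>n\<close> of the
  vectors, and nonnegative costs make \<open>u\<close> no more expensive. These vectors form an
  \<open>n\<close>-tuple competing with \<open>x\<close>, whether \<open>k\<close> is smaller or
  larger than \<open>n\<close>.\<close>

lemma m3_value_optimal_le_opt:
  assumes "m3_optimal X U CARD('n) x" "k \<ge> 1"
  shows "m3_value U CARD('n) x \<le> m3_opt X U k"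
proof -
  obtain y where y: "y \<in> {1..k} \<rightarrow>\<^sub>E X" "m3_opt X U k = m3_value U k y"
    by (rule m3_opt_attained)
  obtain w where w: "w \<in> convex hull (y ` {1..k})" "\<And>c. c \<in> U \<Longrightarrow> c \<bullet> w \<le> m3_value U k y"
    using convex_hull_le_m3_value[OF assms(2) y(1)] by blast
  have yX: "y ` {1..k} \<subseteq> X" using y(1) by auto
  have "0 \<le> a $ i" if "a \<in> X" for a i
    using inst that unfolding m3_instance_def by (metis insertE order_refl singletonD zero_le_one)
  then obtain B u where B: "B \<subseteq> y ` {1..k}" "card B \<le> CARD('n)" "u \<in> convex hull B"
    and u: "\<And>i. u $ i \<le> w $ i"
    using caratheodory_nonneg[of "y ` {1..k}" w] w(1) yX by blast
  have "B \<noteq> {}" using B(3) by auto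
  have "finite B" using B(1) finite_subset by blast
  then obtain h where h: "bij_betw h {1..card B} B"
    using ex_bij_betw_nat_finite_1 by blast
  \<comment> \<open>Positions beyond \<open>card B\<close> repeat \<open>h 1\<close>, so the tuple
    has length exactly \<open>n\<close> and image \<open>B\<close>; \<open>B\<close> is nonempty, so
    \<open>h 1\<close> lies in it.\<close>
  define x' where "x' = (\<lambda>i\<in>{1..CARD('n)}. h (if i \<le> card B then i else 1))"
  have "card B \<ge> 1" using \<open>finite B\<close> \<open>B \<noteq> {}\<close> by (simp add: Suc_le_eq card_gt_0_iff)
  then have x'B: "x' ` {1..CARD('n)} \<subseteq> B"
    using h by (auto simp: x'_def bij_betw_def)
  have "B \<subseteq> x' ` {1..CARD('n)}"
  proof
    fix b assume "b \<in> B"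
    then obtain i where "i \<in> {1..card B}" "b = h i"
      using bij_betw_imp_surj_on[OF h] by blast
    then show "b \<in> x' ` {1..CARD('n)}" using B(2)
      by (intro image_eqI[of _ _ i]) (auto simp: x'_def)
  qed
  with x'B have img: "x' ` {1..CARD('n)} = B" by blast
  have "x' \<in> extensional {1..CARD('n)}" by (simp add: x'_def)
  then have x': "x' \<in> {1..CARD('n)} \<rightarrow>\<^sub>E X" using img B(1) yX by (auto simp: PiE_def)
  have "c \<bullet> u \<le> m3_value U k y" if "c \<in> U" for c
  proof -
    have "c \<bullet> u \<le> c \<bullet> w"
      unfolding inner_vec_def using u inst that
      by (auto simp: m3_instance_def intro!: sum_mono mult_left_mono)
    then show ?thesis using w(2)[OF that] by simp
  qed
  then have "m3_value U CARD('n) x' \<le> m3_value U k y"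
    using x' B(3) img by (intro m3_value_le_convex_hull) (auto simp: Suc_le_eq)
  moreover have "m3_value U CARD('n) x \<le> m3_value U CARD('n) x'"
    using assms(1) x' by (simp add: m3_optimal_def is_arg_min_linorder)
  ultimately show ?thesis using y(2) by simp
qed

text \<open>The hull point supplied by minimax is a convex combination of the tuple, so its weights
  are feasible in the second step of the algorithm.\<close>

lemma comb_value_optimal_le_m3_value:
  assumes "x \<in> {1..CARD('n)} \<rightarrow>\<^sub>E X" "comb_optimal U CARD('n) x l"
  shows "comb_value U CARD('n) x l \<le> m3_value U CARD('n) x"
proof -
  obtain w where w: "w \<in> convex hull (x ` {1..CARD('n)})"
      "\<And>c. c \<in> U \<Longrightarrow> c \<bullet> w \<le> m3_value U CARD('n) x"
    using convex_hull_le_m3_value[OF _ assms(1)] by (auto simp: Suc_le_eq)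
  obtain l' where l': "simplex_weights CARD('n) l'" "w = (\<Sum>i\<in>{1..CARD('n)}. l' i *\<^sub>R x i)"
    using convex_hull_tuple[OF w(1)] .
  have "comb_value U CARD('n) x l \<le> comb_value U CARD('n) x l'"
    using assms(2) l'(1) by (simp add: comb_optimal_def is_arg_min_linorder)
  also have "\<dots> \<le> m3_value U CARD('n) x"
    by (rule comb_value_le) (use w(2) l'(2) in simp)
  finally show ?thesis .
qed

end

section \<open>Cost bounds and sorted weights\<close>

lemma inner_bounds_l0:
  fixes c x :: "real^'n"
  assumes "\<And>j. x $ j \<in> {0, 1}" "\<And>j. m \<le> c $ j" "\<And>j. c $ j \<le> M"
  shows "m * l0 x \<le> c \<bullet> x" "c \<bullet> x \<le> M * l0 x"
proof -
  have "c \<bullet> x = (\<Sum>j\<in>UNIV. c $ j * x $ j)" by (simp add: inner_vec_def)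
  also have "\<dots> = (\<Sum>j\<in>{j. x $ j \<noteq> 0}. c $ j * x $ j)"
    by (rule sum.mono_neutral_right) auto
  also have "\<dots> = (\<Sum>j\<in>{j. x $ j \<noteq> 0}. c $ j)"
  proof (rule sum.cong)
    fix j assume "j \<in> {j. x $ j \<noteq> 0}"
    then have "x $ j = 1" using assms(1)[of j] by auto
    then show "c $ j * x $ j = c $ j" by simp
  qed simp
  finally have eq: "c \<bullet> x = (\<Sum>j\<in>{j. x $ j \<noteq> 0}. c $ j)" .
  show "m * l0 x \<le> c \<bullet> x"
    using sum_mono[of "{j. x $ j \<noteq> 0}" "\<lambda>_. m" "\<lambda>j. c $ j"] assms(2)
    by (simp add: eq l0_def mult.commute)
  show "c \<bullet> x \<le> M * l0 x"
    using sum_mono[of "{j. x $ j \<noteq> 0}" "\<lambda>j. c $ j" "\<lambda>_. M"] assms(3)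
    by (simp add: eq l0_def mult.commute)
qed

text \<open>The first \<open>k + 1\<close> weights are at least \<open>l (k + 1)\<close> and sum to
  at most 1, so \<open>l (k + 1) \<le> 1 / (k + 1)\<close>; each of the \<open>n - k\<close> tail
  weights is bounded by it. For \<open>k = n\<close> position \<open>k + 1\<close> does not exist,
  but the tail is empty.\<close>

lemma sorted_weights_tail:
  fixes l :: "nat \<Rightarrow> real"
  assumes "simplex_weights n l" "k \<le> n"
    and sorted: "\<And>a b. a \<in> {1..n} \<Longrightarrow> b \<in> {1..n} \<Longrightarrow> a \<le> b \<Longrightarrow> l b \<le> l a"
  shows "(\<Sum>i\<in>{k+1..n}. l i) \<le> (real n - real k) / (real k + 1)"
proof (cases "k = n")
  case True
  then show ?thesis by simp
next
  case False
  have "(real k + 1) * l (k + 1) = (\<Sum>i\<in>{1..k+1}. l (k + 1))" by simp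
  also have "\<dots> \<le> (\<Sum>i\<in>{1..k+1}. l i)"
    using False \<open>k \<le> n\<close> by (intro sum_mono sorted) auto
  also have "\<dots> \<le> (\<Sum>i\<in>{1..n}. l i)"
    using False assms(1,2) by (intro sum_mono2) (auto simp: simplex_weights_def)
  also have "\<dots> = 1" using assms(1) by (simp add: simplex_weights_def)
  finally have le: "l (k + 1) \<le> 1 / (real k + 1)" by (simp add: field_simps)
  have "(\<Sum>i\<in>{k+1..n}. l i) \<le> (\<Sum>i\<in>{k+1..n}. l (k + 1))"
    using False by (intro sum_mono sorted) auto
  also have "\<dots> = (real n - real k) * l (k + 1)"
    using \<open>k \<le> n\<close> by (simp add: of_nat_diff)
  also have "\<dots> \<le> (real n - real k) * (1 / (real k + 1))"
    using le \<open>k \<le> n\<close> by (intro mult_left_mono) auto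
  finally show ?thesis by simp
qed

text \<open>As the weights sum to 1, the gap between \<open>\<alpha>\<close> and the combination is
  the weighted sum of the gaps \<open>\<alpha> - a i\<close>. The first \<open>k\<close> are
  nonpositive and the others at most \<open>D\<close>, which leaves \<open>D\<close> times the tail
  weight.\<close>

lemma min_le_sorted_combination:
  fixes l a :: "nat \<Rightarrow> real"
  assumes "simplex_weights n l" "k \<le> n" "D \<ge> 0"
    and "\<And>a b. a \<in> {1..n} \<Longrightarrow> b \<in> {1..n} \<Longrightarrow> a \<le> b \<Longrightarrow> l b \<le> l a"
    and lo: "\<And>i. i \<in> {1..k} \<Longrightarrow> \<alpha> \<le> a i"
    and diff: "\<And>i. i \<in> {k+1..n} \<Longrightarrow> \<alpha> - a i \<le> D"
  shows "\<alpha> \<le> (\<Sum>i\<in>{1..n}. l i * a i) + D * ((real n - real k) / (real k + 1))"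
proof -
  have l: "\<And>i. i \<in> {1..n} \<Longrightarrow> l i \<ge> 0" "sum l {1..n} = 1"
    using assms(1) by (auto simp: simplex_weights_def)
  have "\<alpha> - (\<Sum>i\<in>{1..n}. l i * a i) = (\<Sum>i\<in>{1..n}. l i * (\<alpha> - a i))"
    using l(2) by (simp add: right_diff_distrib sum_subtractf flip: sum_distrib_right)
  also have "\<dots> = (\<Sum>i\<in>{1..k}. l i * (\<alpha> - a i)) + (\<Sum>i\<in>{k+1..n}. l i * (\<alpha> - a i))"
    using sum.ub_add_nat[of 1 k "\<lambda>i. l i * (\<alpha> - a i)" "n - k"] \<open>k \<le> n\<close> by simp
  also have "\<dots> \<le> 0 + (\<Sum>i\<in>{k+1..n}. l i * D)"
  proof (rule add_mono)
    show "(\<Sum>i\<in>{1..k}. l i * (\<alpha> - a i)) \<le> 0"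
      using l(1) lo \<open>k \<le> n\<close> by (intro sum_nonpos mult_nonneg_nonpos) auto
    show "(\<Sum>i\<in>{k+1..n}. l i * (\<alpha> - a i)) \<le> (\<Sum>i\<in>{k+1..n}. l i * D)"
      using l(1) diff by (intro sum_mono mult_left_mono) auto
  qed
  also have "\<dots> = D * (\<Sum>i\<in>{k+1..n}. l i)" by (simp add: sum_distrib_left mult.commute)
  also have "\<dots> \<le> D * ((real n - real k) / (real k + 1))"
    using assms(1-4) by (intro mult_left_mono sorted_weights_tail) auto
  finally show ?thesis by simp
qed

section \<open>The approximation guarantee\<close>

theorem corollary4:
  fixes \<C> :: "((real^'n) set \<times> (real^'n) set) set"
    and X U :: "(real^'n) set"
    and p_lo p_hi :: "nat \<Rightarrow> real"
    and m_inf M_inf :: real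
    and k :: nat
    and z :: "nat \<Rightarrow> real^'n"
  defines "M \<equiv> \<lambda>n. M_inf * p_hi n - m_inf * p_lo n"
  assumes "\<forall>(X', U')\<in>\<C>. m3_instance X' U'"
    and "cardinality_bounds \<C> p_lo p_hi"
    and "(X, U) \<in> \<C>"
    and "cost_bounds U m_inf M_inf"
    and "maxima_attained X U"
    and "k \<in> {1..CARD('n)}"
    and "algorithm1 X U k z"
  shows "\<forall>k'\<ge>k. m3_value U k z \<le>
           m3_opt X U k' + M CARD('n) * ((real CARD('n) - real k) / (real k + 1))"
proof (intro allI impI)
  fix k' assume "k' \<ge> k"
  let ?n = "CARD('n)"
  have inst: "m3_instance X U" using assms(2,4) by auto
  note max_att = assms(6)
  have k: "k \<ge> 1" "k \<le> ?n" using assms(7) by auto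
  obtain x l s where opt: "m3_optimal X U ?n x" and comb: "comb_optimal U ?n x l"
    and s: "bij_betw s {1..?n} {1..?n}"
    and sorted: "\<And>a b. a \<in> {1..?n} \<Longrightarrow> b \<in> {1..?n} \<Longrightarrow> a \<le> b \<Longrightarrow> l (s b) \<le> l (s a)"
    and z: "z = (\<lambda>j\<in>{1..k}. x (s j))"
    using assms(8) unfolding algorithm1_def by blast
  have x: "x \<in> {1..?n} \<rightarrow>\<^sub>E X" using opt by (simp add: m3_optimal_def is_arg_min_def)
  have l: "simplex_weights ?n l" using comb by (simp add: comb_optimal_def is_arg_min_def)
  have s_in: "s i \<in> {1..?n}" if "i \<in> {1..?n}" for i using s that by (auto simp: bij_betw_def)
  have xs: "x (s i) \<in> X" if "i \<in> {1..?n}" for i using s_in[OF that] x by auto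
  have "z \<in> {1..k} \<rightarrow>\<^sub>E X" using xs k(2) by (auto simp: z)
  \<comment> \<open>A worst-case cost vector for the returned tuple; the weighted estimate is
    carried out for this single \<open>c\<close>.\<close>
  then obtain c where c: "c \<in> U" "m3_value U k z = (MIN i\<in>{1..k}. c \<bullet> z i)"
    using m3_value_attained[OF inst max_att k(1)] by blast
  have cost: "0 < m_inf" "m_inf \<le> M_inf" "\<And>j. m_inf \<le> c $ j" "\<And>j. c $ j \<le> M_inf"
    using assms(5) c(1) by (auto simp: cost_bounds_def)
  have bounds: "m_inf * p_lo ?n \<le> c \<bullet> y" "c \<bullet> y \<le> M_inf * p_hi ?n" if "y \<in> X" for y
  proof -
    have "\<And>j. y $ j \<in> {0, 1}" using inst that by (auto simp: m3_instance_def)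
    note y = inner_bounds_l0[OF this cost(3,4)]
    have card: "p_lo ?n \<le> l0 y" "l0 y \<le> p_hi ?n"
      using assms(3,4) that by (auto simp: cardinality_bounds_def)
    show "m_inf * p_lo ?n \<le> c \<bullet> y"
      using mult_left_mono[OF card(1), of m_inf] y(1) cost(1) by linarith
    show "c \<bullet> y \<le> M_inf * p_hi ?n"
      using mult_left_mono[OF card(2), of M_inf] y(2) cost(1,2) by linarith
  qed
  have le: "m3_value U k z \<le> c \<bullet> x (s i)" if "i \<in> {1..k}" for i
  proof -
    have "(MIN i\<in>{1..k}. c \<bullet> z i) \<le> c \<bullet> z i" using that by (intro Min_le) auto
    also have "c \<bullet> z i = c \<bullet> x (s i)" using that by (simp add: z)
    finally show ?thesis unfolding c(2) .
  qed
  \<comment> \<open>The value of \<open>z\<close> is at most the cost of its first member, which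
    exists as \<open>k \<ge> 1\<close>; two costs of members of \<open>X\<close> differ by at most
    \<open>M(n)\<close>.\<close>
  have "m3_value U k z - c \<bullet> x (s i) \<le> M ?n" if "i \<in> {1..?n}" for i
    using le[of 1] bounds(2)[OF xs[of 1]] bounds(1)[OF xs[OF that]] k by (auto simp: M_def)
  moreover have "M ?n \<ge> 0"
    using bounds[OF xs[of 1]] k by (simp add: M_def)
  moreover have "simplex_weights ?n (\<lambda>i. l (s i))"
    using l s_in sum.reindex_bij_betw[OF s, of l] by (simp add: simplex_weights_def)
  ultimately have "m3_value U k z \<le> (\<Sum>i\<in>{1..?n}. l (s i) * (c \<bullet> x (s i)))
      + M ?n * ((real ?n - real k) / (real k + 1))"
    using k(2) sorted le by (intro min_le_sorted_combination) auto
  \<comment> \<open>Undoing the sorting turns the sum into the cost of the combination from the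
    second step, whose worst case is bounded by \<open>opt(n)\<close> and hence by
    \<open>opt(k')\<close>.\<close>
  also have "(\<Sum>i\<in>{1..?n}. l (s i) * (c \<bullet> x (s i))) = (\<Sum>i\<in>{1..?n}. l i * (c \<bullet> x i))"
    by (rule sum.reindex_bij_betw[OF s])
  also have "\<dots> = c \<bullet> (\<Sum>i\<in>{1..?n}. l i *\<^sub>R x i)" by (simp add: inner_sum_right)
  also have "\<dots> \<le> comb_value U ?n x l"
    by (rule le_comb_value[OF inst max_att x l c(1)])
  also have "\<dots> \<le> m3_value U ?n x"
    by (rule comb_value_optimal_le_m3_value[OF inst max_att x comb])
  also have "\<dots> \<le> m3_opt X U k'"
    using k(1) \<open>k' \<ge> k\<close> by (intro m3_value_optimal_le_opt[OF inst max_att opt]) simp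
  finally show "m3_value U k z \<le> m3_opt X U k' + M ?n * ((real ?n - real k) / (real k + 1))"
    by simp
qed

end
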